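(* Let $\mathcal{B}$ be a complex unital Banach algebra which is reflexive as a Banach space ($\mathcal{B} = \mathcal{B}^{**}$ via the canonical embedding), let $n \geq 1$, and let $A = (A_0, A_1, \dots, A_n)$ be an $(n+1)$-tuple of elements of $\mathcal{B}$. Then every connected component of $P^c(A)$ is a domain of holomorphy in $\mathbb{C}^{n+1}$.
   Context: For $z = (z_0, \dots, z_n) \in \mathbb{C}^{n+1}$ put $A(z) = z_0A_0 + z_1A_1 + \cdots + z_nA_n \in \mathcal{B}$, $P(A) = \{z \in \mathbb{C}^{n+1} : A(z) \text{ is not invertible in } \mathcal{B}\}$, and $P^c(A) = \mathbb{C}^{n+1} \setminus P(A)$, which is an open subset of $\mathbb{C}^{n+1}$. The elements of the tuple are not assumed to commute. *)

theory Defs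
  imports "HOL-Analysis.Analysis"
begin

class scaleC =
  fixes scaleC :: "complex \<Rightarrow> 'a \<Rightarrow> 'a" (infixr \<open>*\<^sub>C\<close> 75)

class complex_normed_vector = real_normed_vector + scaleC +
  assumes scaleC_add_right: "c *\<^sub>C (x + y) = c *\<^sub>C x + c *\<^sub>C y"
    and scaleC_add_left: "(c + d) *\<^sub>C x = c *\<^sub>C x + d *\<^sub>C x"
    and scaleC_scaleC: "c *\<^sub>C d *\<^sub>C x = (c * d) *\<^sub>C x"
    and scaleR_scaleC: "r *\<^sub>R x = complex_of_real r *\<^sub>C x"
    and norm_scaleC: "norm (c *\<^sub>C x) = cmod c * norm x"

text \<open>The norm is submultiplicative and \<open>norm 1 = 1\<close>, both inherited from
  \<open>real_normed_algebra_1\<close>; multiplication need not commute.\<close>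

class complex_normed_algebra_1 = complex_normed_vector + real_normed_algebra_1 +
  assumes mult_scaleC_left: "(c *\<^sub>C x) * y = c *\<^sub>C (x * y)"
    and mult_scaleC_right: "x * (c *\<^sub>C y) = c *\<^sub>C (x * y)"

class complex_banach_algebra_1 = complex_normed_algebra_1 + banach

definition cdual :: "('a::complex_normed_vector \<Rightarrow> complex) set" where
  "cdual = {f. bounded_linear f \<and> (\<forall>c x. f (c *\<^sub>C x) = c * f x)}"

text \<open>The dual norm on \<^term>\<open>cdual\<close> is \<^const>\<open>onorm\<close>. Elements of the bidual are
  functions on \<^term>\<open>cdual\<close>; extensionality fixes their irrelevant values elsewhere.\<close>

definition cbidual :: "(('a::complex_normed_vector \<Rightarrow> complex) \<Rightarrow> complex) set" where
  "cbidual = {\<Phi> \<in> extensional cdual.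
     (\<forall>f\<in>cdual. \<forall>g\<in>cdual. \<Phi> (\<lambda>x. f x + g x) = \<Phi> f + \<Phi> g) \<and>
     (\<forall>c. \<forall>f\<in>cdual. \<Phi> (\<lambda>x. c * f x) = c * \<Phi> f) \<and>
     (\<exists>K. \<forall>f\<in>cdual. cmod (\<Phi> f) \<le> K * onorm f)}"

definition canonical_embedding ::
    "'a::complex_normed_vector \<Rightarrow> ('a \<Rightarrow> complex) \<Rightarrow> complex" where
  "canonical_embedding x = (\<lambda>f\<in>cdual. f x)"

definition reflexive_space :: "'a::complex_normed_vector itself \<Rightarrow> bool" where
  "reflexive_space _ \<longleftrightarrow>
     range (canonical_embedding :: 'a \<Rightarrow> ('a \<Rightarrow> complex) \<Rightarrow> complex) = cbidual"

definition invertible_element :: "'a::monoid_mult \<Rightarrow> bool" where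
  "invertible_element x \<longleftrightarrow> (\<exists>y. x * y = 1 \<and> y * x = 1)"

definition pencil :: "'b::complex_banach_algebra_1 ^ 'n::finite \<Rightarrow> complex ^ 'n \<Rightarrow> 'b" where
  "pencil A z = (\<Sum>i\<in>UNIV. (z $ i) *\<^sub>C (A $ i))"

definition proj_spectrum ::
    "'b::complex_banach_algebra_1 ^ 'n::finite \<Rightarrow> (complex ^ 'n) set" where
  "proj_spectrum A = {z. \<not> invertible_element (pencil A z)}"

definition proj_resolvent_set ::
    "'b::complex_banach_algebra_1 ^ 'n::finite \<Rightarrow> (complex ^ 'n) set" where
  "proj_resolvent_set A = UNIV - proj_spectrum A"

text \<open>Holomorphy in several variables: the Frechet derivative exists at every point and
  is complex linear. It is only used on open sets.\<close>

definition holomorphic_Cn_on ::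
    "(complex ^ 'n::finite \<Rightarrow> complex) \<Rightarrow> (complex ^ 'n) set \<Rightarrow> bool" where
  "holomorphic_Cn_on f S \<longleftrightarrow>
     (\<forall>z\<in>S. \<exists>D. (f has_derivative D) (at z within S) \<and> (\<forall>c v. D (c *s v) = c * D v))"

text \<open>Hoermander's definition, for domains (nonempty connected open sets): there is no
  connected open \<open>V\<close> sticking out of \<open>\<Omega>\<close> into which all functions holomorphic on \<open>\<Omega>\<close>
  extend simultaneously. Agreement is only required on a nonempty open
  \<open>U \<subseteq> V \<inter> \<Omega>\<close>, since \<open>V \<inter> \<Omega>\<close> may be disconnected and the extension may be
  multivalued with respect to \<open>\<Omega>\<close>.\<close>

definition domain_of_holomorphy :: "(complex ^ 'n::finite) set \<Rightarrow> bool" where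
  "domain_of_holomorphy \<Omega> \<longleftrightarrow>
     open \<Omega> \<and> connected \<Omega> \<and> \<Omega> \<noteq> {} \<and>
     \<not> (\<exists>U V. open U \<and> open V \<and> connected V \<and> \<not> V \<subseteq> \<Omega> \<and> U \<noteq> {} \<and> U \<subseteq> V \<inter> \<Omega> \<and>
          (\<forall>f. holomorphic_Cn_on f \<Omega> \<longrightarrow>
             (\<exists>F. holomorphic_Cn_on F V \<and> (\<forall>z\<in>U. F z = f z))))"

end

theory Submission
  imports Defs "HOL-Complex_Analysis.Conformal_Mappings"
begin

text \<open>For every continuous linear functional \<open>\<phi>\<close> the function \<open>\<phi> (A(z)\<inverse>)\<close> is holomorphic on
  \<open>\<Omega>\<close>. If all of them extended across a boundary point \<open>p\<close> of \<open>\<Omega>\<close>, then along a sequence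
  \<open>z\<^sub>k \<longlonglongrightarrow> p\<close> the inverses \<open>A(z\<^sub>k)\<inverse>\<close> would be weakly bounded, hence bounded in norm by the
  uniform boundedness principle. A Neumann series then makes \<open>A(p)\<close> invertible, so that
  \<open>p\<close> lies in the open set \<open>P\<^sup>c(A)\<close> and cannot be a boundary point of one of its components.\<close>

section \<open>Norming functionals and uniform boundedness\<close>

text \<open>Partial functionals are represented by their graphs. A subspace of \<open>'a \<times> real\<close> on
  which \<open>r \<le> norm y\<close> is automatically single-valued.\<close>

lemma dominated_graph_extend:
  fixes g :: "('a::real_normed_vector \<times> real) set"
  assumes g: "subspace g" and dom: "\<And>y r. (y, r) \<in> g \<Longrightarrow> r \<le> norm y"
  obtains a where "\<And>y r. (y, r) \<in> span (insert (y0, a) g) \<Longrightarrow> r \<le> norm y"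
proof -
  \<comment> \<open>A value \<open>a\<close> at \<open>y0\<close> is admissible for the coefficients
    1 and -1 iff \<open>r - norm (y - y0) \<le> a \<le> norm (y' + y0) - r'\<close> for all pairs in
    \<open>g\<close>. \<open>L\<close> collects the lower bounds, and its supremum is the value
    chosen.\<close>
  define L where "L = (\<lambda>(y, r). r - norm (y - y0)) ` g"
  have LU: "r - norm (y - y0) \<le> norm (y' + y0) - r'" if "(y, r) \<in> g" "(y', r') \<in> g" for y r y' r'
  proof -
    have "r + r' \<le> norm (y + y')"
      using dom subspace_add[OF g that] by simp
    also have "\<dots> \<le> norm (y - y0) + norm (y' + y0)"
      using norm_triangle_ineq[of "y - y0" "y' + y0"] by simp
    finally show ?thesis by simp
  qed
  have g0: "(0, 0) \<in> g"
    using subspace_0[OF g] by (simp add: zero_prod_def)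
  then have "L \<noteq> {}" by (auto simp: L_def)
  have "bdd_above L"
    unfolding L_def using LU[OF _ g0] by (intro bdd_aboveI2[where M = "norm y0"]) auto
  define a where "a = Sup L"
  have lower: "r - a \<le> norm (y - y0)" if "(y, r) \<in> g" for y r
    using cSup_upper[OF _ \<open>bdd_above L\<close>, of "r - norm (y - y0)"] that
    by (force simp: a_def L_def)
  have upper: "r + a \<le> norm (y + y0)" if "(y, r) \<in> g" for y r
  proof -
    have "a \<le> norm (y + y0) - r"
      unfolding a_def using \<open>L \<noteq> {}\<close> LU[OF _ that] by (intro cSup_least) (auto simp: L_def)
    then show ?thesis by simp
  qed
  \<comment> \<open>Dividing by \<open>\<bar>t\<bar>\<close> reduces every nonzero \<open>t\<close>
    to the coefficients 1 and -1, which are \<open>upper\<close> and \<open>lower\<close>.\<close>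
  have bound: "r + t * a \<le> norm (y + t *\<^sub>R y0)" if "(y, r) \<in> g" for y r t
  proof (cases "t = 0")
    case True
    then show ?thesis using dom that by simp
  next
    case False
    define s where "s = \<bar>t\<bar>"
    have "s > 0" using False by (simp add: s_def)
    have scaled: "(y /\<^sub>R s, r / s) \<in> g"
      using subspace_scale[OF g that, of "inverse s"] by (simp add: divide_inverse mult.commute)
    have "r / s + sgn t * a \<le> norm (y /\<^sub>R s + sgn t *\<^sub>R y0)"
      using lower[OF scaled] upper[OF scaled] False by (cases "t > 0") (auto simp: sgn_if)
    then have "s * (r / s + sgn t * a) \<le> s * norm (y /\<^sub>R s + sgn t *\<^sub>R y0)"
      using \<open>s > 0\<close> by (intro mult_left_mono) auto
    also have "\<dots> = norm (s *\<^sub>R (y /\<^sub>R s + sgn t *\<^sub>R y0))"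
      using \<open>s > 0\<close> by simp
    also have "s *\<^sub>R (y /\<^sub>R s + sgn t *\<^sub>R y0) = y + t *\<^sub>R y0"
      using \<open>s > 0\<close> by (simp add: scaleR_add_right s_def abs_mult_sgn mult.commute)
    also have "s * (r / s + sgn t * a) = r + t * a"
      using \<open>s > 0\<close> by (simp add: distrib_left s_def mult.assoc[symmetric] abs_mult_sgn)
    finally show ?thesis .
  qed
  have "r \<le> norm y" if yr: "(y, r) \<in> span (insert (y0, a) g)" for y r
  proof -
    obtain k where "(y, r) - k *\<^sub>R (y0, a) \<in> span g"
      using yr span_breakdown_eq by blast
    then have "(y - k *\<^sub>R y0, r - k * a) \<in> g"
      using g by (simp add: span_eq_iff[THEN iffD2])
    from bound[OF this, of k] show ?thesis by simp
  qed
  then show thesis by (rule that)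
qed

text \<open>Hahn-Banach by Zorn's lemma on dominated graphs containing \<open>(x, norm x)\<close>: a
  maximal graph must be defined everywhere, since otherwise \<open>dominated_graph_extend\<close>
  would enlarge it.\<close>

lemma norming_functional:
  fixes x :: "'a::real_normed_vector"
  obtains f :: "'a \<Rightarrow>\<^sub>L real" where "norm f \<le> 1" and "blinfun_apply f x = norm x"
proof -
  define G where "G = {g. subspace g \<and> (x, norm x) \<in> g \<and> (\<forall>(y, r)\<in>g. r \<le> norm y)}"
  have "span {(x, norm x)} \<in> G"
    unfolding G_def
    by (auto simp: span_base) (auto simp: span_singleton intro!: mult_right_mono)
  moreover have "\<Union>C \<in> G" if "C \<noteq> {}" and C: "subset.chain G C" for C
  proof -
    have CG: "C \<subseteq> G" and cmp: "\<And>g h. g \<in> C \<Longrightarrow> h \<in> C \<Longrightarrow> g \<subseteq> h \<or> h \<subseteq> g"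
      using C by (auto simp: subset_chain_def)
    have sub: "\<And>g. g \<in> C \<Longrightarrow> subspace g" using CG by (auto simp: G_def)
    have "subspace (\<Union>C)"
    proof (rule subspaceI)
      show "0 \<in> \<Union>C" using \<open>C \<noteq> {}\<close> sub subspace_0 by blast
      show "u + v \<in> \<Union>C" if "u \<in> \<Union>C" "v \<in> \<Union>C" for u v
        using that cmp sub by (meson UnionE UnionI subsetD subspace_add)
      show "c *\<^sub>R u \<in> \<Union>C" if "u \<in> \<Union>C" for c u
        using that sub by (meson UnionE UnionI subspace_scale)
    qed
    then show ?thesis using CG \<open>C \<noteq> {}\<close> by (fastforce simp: G_def)
  qed
  ultimately obtain g where "g \<in> G" and max: "\<And>h. h \<in> G \<Longrightarrow> g \<subseteq> h \<Longrightarrow> h = g"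
    using subset_Zorn_nonempty[of G] by blast
  then have g: "subspace g" and xg: "(x, norm x) \<in> g"
    and dom: "\<And>y r. (y, r) \<in> g \<Longrightarrow> r \<le> norm y"
    by (auto simp: G_def)
  have total: "\<exists>a. (y, a) \<in> g" for y
  proof -
    obtain a where "\<And>z r. (z, r) \<in> span (insert (y, a) g) \<Longrightarrow> r \<le> norm z"
      using dominated_graph_extend[OF g dom] by blast
    then have "span (insert (y, a) g) \<in> G"
      using xg by (auto simp: G_def intro: span_base)
    then have "span (insert (y, a) g) = g"
      by (intro max) (auto intro: span_base)
    then show ?thesis by (metis insertI1 span_base)
  qed
  \<comment> \<open>Both \<open>(0, r - s)\<close> and \<open>(0, s - r)\<close> lie in
    \<open>g\<close>, so domination by \<open>norm 0\<close> forces the two differences to be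
    nonpositive.\<close>
  have unique: "r = s" if "(y, r) \<in> g" "(y, s) \<in> g" for y r s
    using dom[of 0 "r - s"] dom[of 0 "s - r"] subspace_diff[OF g that]
      subspace_diff[OF g that(2,1)] by simp
  define f where "f y = (THE r. (y, r) \<in> g)" for y
  have fg: "(y, f y) \<in> g" for y
    unfolding f_def by (rule theI') (use total[of y] unique in blast)
  have fI: "f y = r" if "(y, r) \<in> g" for y r
    using unique fg that by blast
  have lin: "linear f"
  proof (rule linearI)
    show "f (u + v) = f u + f v" for u v
      using subspace_add[OF g fg fg] by (intro fI) simp
    show "f (c *\<^sub>R u) = c *\<^sub>R f u" for c u
      using subspace_scale[OF g fg] by (intro fI) simp
  qed
  \<comment> \<open>The one-sided domination, applied at \<open>y\<close> and at \<open>- y\<close>,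
    bounds the absolute value.\<close>
  have le: "norm (f y) \<le> 1 * norm y" for y
    using dom[OF fg, of y] dom[OF fg, of "- y"] linear_neg[OF lin, of y] by auto
  have bl: "bounded_linear f"
    using lin le by (intro bounded_linear_intro[where K = 1]) (auto simp: linear_add linear_scale)
  show thesis
  proof
    show "norm (Blinfun f) \<le> 1"
      using le by (intro norm_blinfun_bound) (auto simp: bounded_linear_Blinfun_apply[OF bl])
    show "blinfun_apply (Blinfun f) x = norm x"
      by (simp add: bounded_linear_Blinfun_apply[OF bl] fI[OF xg])
  qed
qed

text \<open>Elements of \<open>S\<close> act by evaluation on the dual, which is a Banach space even
  if \<open>'a\<close> is not complete. Baire's theorem there gives a uniform bound on a ball of
  functionals, and norming functionals turn it into a bound on norms.\<close>

lemma weakly_bounded_imp_bounded: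
  fixes S :: "'a::real_normed_vector set"
  assumes "\<And>f :: 'a \<Rightarrow>\<^sub>L real. bounded (blinfun_apply f ` S)"
  shows "bounded S"
proof -
  define T :: "nat \<Rightarrow> ('a \<Rightarrow>\<^sub>L real) set" where
    "T N = (\<Inter>x\<in>S. {f. \<bar>blinfun_apply f x\<bar> \<le> real N})" for N
  have closed: "closed (T N)" for N
    unfolding T_def
    by (intro closed_INT ballI closed_Collect_le continuous_intros blinfun.continuous_on)
  have "f \<in> \<Union>(range T)" for f
  proof -
    obtain B where "\<And>x. x \<in> S \<Longrightarrow> \<bar>blinfun_apply f x\<bar> \<le> B"
      using assms[of f] by (auto simp: bounded_iff)
    moreover obtain N where "B \<le> real N" using real_arch_simple by blast
    ultimately have "f \<in> T N"
      unfolding T_def by (auto intro: order_trans)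
    then show ?thesis by blast
  qed
  then have "\<Union>(range T) = UNIV" by blast
  then have "\<exists>N. interior (T N) \<noteq> {}"
    using Baire_category_alt[of "euclidean :: ('a \<Rightarrow>\<^sub>L real) topology" "range T"] closed
    by (force simp: completely_metrizable_space_euclidean)
  then obtain N f0 where "f0 \<in> interior (T N)" by blast
  then obtain r where "r > 0" and r: "cball f0 r \<subseteq> T N"
    by (auto simp: mem_interior_cball)
  \<comment> \<open>Both \<open>f0\<close> and \<open>f0 + r *\<^sub>R h\<close> lie in
    \<open>T N\<close>, so their difference \<open>r *\<^sub>R h\<close> is at most
    \<open>2 * real N\<close> at \<open>x\<close>, where \<open>h\<close> takes the value
    \<open>norm x\<close>.\<close>
  have "norm x \<le> 2 * real N / r" if "x \<in> S" for x
  proof -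
    obtain h :: "'a \<Rightarrow>\<^sub>L real" where h: "norm h \<le> 1" "blinfun_apply h x = norm x"
      using norming_functional by blast
    have "f0 + r *\<^sub>R h \<in> T N"
      using h \<open>r > 0\<close> by (intro subsetD[OF r]) (auto simp: dist_norm)
    moreover have "f0 \<in> T N" using r \<open>r > 0\<close> by auto
    ultimately have "\<bar>blinfun_apply f0 x + r * norm x\<bar> \<le> real N" "\<bar>blinfun_apply f0 x\<bar> \<le> real N"
      using \<open>x \<in> S\<close> h by (auto simp: T_def blinfun.add_left blinfun.scaleR_left)
    then have "r * norm x \<le> 2 * real N" by linarith
    then show ?thesis using \<open>r > 0\<close> by (simp add: field_simps)
  qed
  then show ?thesis by (auto simp: bounded_iff)
qed

section \<open>Inverses in a Banach algebra\<close>

lemma invertible_element_one_minus: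
  fixes x :: "'a::{real_normed_algebra_1,banach}"
  assumes "norm x < 1"
  shows "invertible_element (1 - x)"
proof -
  have s: "summable (\<lambda>n. x ^ n)"
    using assms by (rule complete_algebra_summable_geometric)
  define y where "y = (\<Sum>n. x ^ n)"
  have tail: "(\<Sum>n. x ^ Suc n) = y - 1"
    using suminf_split_head[OF s] by (simp add: y_def)
  have "x * y = y - 1"
    using suminf_mult[OF s, of x] tail by (simp add: y_def)
  moreover have "y * x = y - 1"
    using suminf_mult2[OF s, of x] tail by (simp add: y_def power_commutes)
  ultimately show ?thesis
    unfolding invertible_element_def by (intro exI[of _ y]) (simp add: algebra_simps)
qed

lemma invertible_element_mult:
  assumes "invertible_element x" "invertible_element y"
  shows "invertible_element (x * y)"
proof -
  obtain x' y' where "x * x' = 1" "x' * x = 1" "y * y' = 1" "y' * y = 1"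
    using assms by (auto simp: invertible_element_def)
  then have "(x * y) * (y' * x') = 1" "(y' * x') * (x * y) = 1"
    by (metis mult.assoc mult_1_left)+
  then show ?thesis by (auto simp: invertible_element_def)
qed

text \<open>Factor \<open>a + h = a * (1 + g * h)\<close> and apply the Neumann series to the second
  factor. The admissible size of \<open>h\<close> depends only on \<open>norm g\<close>, so a common
  bound on inverses gives a common radius of invertibility.\<close>

lemma invertible_element_perturb:
  fixes a :: "'a::{real_normed_algebra_1,banach}"
  assumes "a * g = 1" "g * a = 1" "norm g * norm h < 1"
  shows "invertible_element (a + h)"
proof -
  have "norm (- (g * h)) < 1"
    using norm_mult_ineq[of g h] assms(3) by simp
  then have "invertible_element (1 - - (g * h))"
    by (rule invertible_element_one_minus)
  moreover have "invertible_element a"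
    using assms by (auto simp: invertible_element_def)
  ultimately have "invertible_element (a * (1 - - (g * h)))"
    by (rule invertible_element_mult[rotated])
  also have "a * (1 - - (g * h)) = a + h"
    using assms(1) by (simp add: distrib_left mult.assoc[symmetric])
  finally show ?thesis .
qed

text \<open>Two-sided inverses are unique, so the choice is determined on invertible elements;
  elsewhere the value is arbitrary.\<close>

definition element_inverse :: "'a::monoid_mult \<Rightarrow> 'a" where
  "element_inverse x = (SOME y. x * y = 1 \<and> y * x = 1)"

lemma element_inverse:
  assumes "invertible_element x"
  shows "x * element_inverse x = 1" "element_inverse x * x = 1"
  using someI_ex[OF assms[unfolded invertible_element_def]] by (auto simp: element_inverse_def)

lemma open_invertible_elements:
  "open {x :: 'a::{real_normed_algebra_1,banach}. invertible_element x}"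
  unfolding open_dist
proof (intro ballI)
  fix a :: 'a assume "a \<in> {x. invertible_element x}"
  then have a: "invertible_element a" by simp
  define g where "g = element_inverse a"
  \<comment> \<open>The summand 1 keeps the denominator positive without a separate argument that
    \<open>g\<close> is nonzero.\<close>
  have "invertible_element y" if "dist y a < 1 / (norm g + 1)" for y
  proof -
    have "norm g * norm (y - a) \<le> (norm g + 1) * norm (y - a)"
      by (intro mult_right_mono) auto
    also have "\<dots> < 1"
      using that by (simp add: dist_norm pos_less_divide_eq add_nonneg_pos mult.commute)
    finally show ?thesis
      using invertible_element_perturb[OF element_inverse[OF a, folded g_def], of "y - a"] by simp
  qed
  moreover have "1 / (norm g + 1) > 0" by (simp add: add_nonneg_pos)
  ultimately show "\<exists>e>0. \<forall>y. dist y a < e \<longrightarrow> y \<in> {x. invertible_element x}"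
    by blast
qed

text \<open>With \<open>k\<close> the inverse of \<open>y = a + h\<close>, the resolvent identity
  \<open>g - k = k * h * g\<close>, used twice, shows that the error of the linear approximation is
  \<open>k * h * g * h * g\<close>, which is quadratic in \<open>h\<close>.\<close>

lemma has_derivative_element_inverse:
  fixes a :: "'a::{real_normed_algebra_1,banach}"
  assumes a: "invertible_element a"
  shows "(element_inverse has_derivative (\<lambda>h. - (element_inverse a * h * element_inverse a))) (at a)"
proof -
  define g where "g = element_inverse a"
  note ag = element_inverse[OF a, folded g_def]
  obtain d where "d > 0" and d: "\<And>y. dist y a < d \<Longrightarrow> invertible_element y"
    using open_invertible_elements a by (force simp: open_dist)
  \<comment> \<open>The first bound keeps \<open>y\<close> invertible. The second gives
    \<open>norm h * norm g \<le> 1 / 2\<close>, so that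
    \<open>norm k \<le> norm g + norm k / 2\<close> and hence
    \<open>norm k \<le> 2 * norm g\<close>.\<close>
  define e where "e = min d (1 / (2 * (norm g + 1)))"
  have e: "e > 0" using \<open>d > 0\<close> by (simp add: e_def add_nonneg_pos)
  have est: "norm (element_inverse y - g - - (g * (y - a) * g)) / norm (y - a)
      \<le> 2 * norm g ^ 3 * norm (y - a)" if "dist y a < e" "y \<noteq> a" for y
  proof -
    define h k where "h = y - a" and "k = element_inverse y"
    have yk: "y * k = 1" "k * y = 1"
      using element_inverse[OF d] that(1) by (auto simp: e_def k_def)
    have diff: "g - k = k * h * g"
    proof -
      have "k * h * g = (k * y) * g - k * (a * g)"
        by (simp add: h_def algebra_simps)
      then show ?thesis using yk ag by simp
    qed
    have "norm h \<le> 1 / (2 * (norm g + 1))"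
      using that(1) by (simp add: e_def h_def dist_norm)
    then have "norm g * norm h \<le> (norm g + 1) * (1 / (2 * (norm g + 1)))"
      by (intro mult_mono) auto
    also have "\<dots> = 1 / 2"
      by (simp add: field_simps add_nonneg_eq_0_iff)
    finally have small: "norm h * norm g \<le> 1 / 2" by (simp add: mult.commute)
    have khg: "norm (k * h * g) \<le> norm k * (norm h * norm g)"
      unfolding mult.assoc
      by (intro order_trans[OF norm_mult_ineq] mult_left_mono norm_mult_ineq norm_ge_zero)
    have "norm k \<le> norm g + norm (g - k)"
      using norm_triangle_ineq2[of k g] by (simp add: norm_minus_commute)
    also have "norm (g - k) \<le> norm k * (1 / 2)"
      unfolding diff using khg small by (meson mult_left_mono norm_ge_zero order_trans)
    finally have k2: "norm k \<le> 2 * norm g" by simp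
    have "k - g - - (g * h * g) = (g - k) * (h * g)"
      using diff by (simp add: algebra_simps)
    then have "norm (k - g - - (g * h * g)) = norm ((k * h * g) * (h * g))"
      by (simp add: diff)
    also have "\<dots> \<le> norm (k * h * g) * norm (h * g)"
      by (rule norm_mult_ineq)
    also have "\<dots> \<le> (2 * norm g * (norm h * norm g)) * (norm h * norm g)"
      using khg k2
      by (intro mult_mono norm_mult_ineq order_trans[OF khg] mult_right_mono) auto
    also have "\<dots> = 2 * norm g ^ 3 * norm h * norm h"
      by (simp add: power3_eq_cube)
    finally show ?thesis
      using that(2) by (simp add: divide_le_eq h_def k_def)
  qed
  have "(element_inverse has_derivative (\<lambda>h. - (g * h * g))) (at a within UNIV)"
  proof (rule has_derivativeI_sandwich[OF e])
    show "bounded_linear (\<lambda>h. - (g * h * g))"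
      by (intro bounded_linear_intros bounded_linear_minus)
    show "norm (element_inverse y - element_inverse a - - (g * (y - a) * g)) / norm (y - a)
        \<le> 2 * norm g ^ 3 * norm (y - a)" if "y \<noteq> a" "dist y a < e" for y
      using est that by (simp add: g_def)
    have "((\<lambda>y. 2 * norm g ^ 3 * norm (y - a)) \<longlongrightarrow> 2 * norm g ^ 3 * norm (a - a)) (at a)"
      by (intro tendsto_intros)
    then show "((\<lambda>y. 2 * norm g ^ 3 * norm (y - a)) \<longlongrightarrow> 0) (at a)"
      by simp
  qed
  then show ?thesis by (simp add: g_def)
qed

section \<open>The pencil and its resolvent\<close>

lemma bounded_linear_pencil: "bounded_linear (pencil A)"
  unfolding pencil_def
proof (rule bounded_linear_sum)
  fix i
  have "bounded_linear (\<lambda>c. c *\<^sub>C (A $ i))"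
    by (intro bounded_linear_intro[where K = "norm (A $ i)"])
      (simp_all add: scaleC_add_left scaleR_scaleC scaleC_scaleC norm_scaleC scaleR_conv_of_real)
  from bounded_linear_compose[OF this bounded_linear_vec_nth]
  show "bounded_linear (\<lambda>z. (z $ i) *\<^sub>C (A $ i))" .
qed

lemma scaleC_zero_right [simp]: "c *\<^sub>C (0::'a::complex_normed_vector) = 0"
  using scaleC_add_right[of c "0::'a" 0] by simp

lemma pencil_scale:
  fixes A :: "'a::complex_banach_algebra_1 ^ 'n::finite"
  shows "pencil A (c *s z) = c *\<^sub>C pencil A z"
proof -
  have "c *\<^sub>C (\<Sum>i\<in>I. f i) = (\<Sum>i\<in>I. c *\<^sub>C f i)" if "finite I" for I and f :: "'n \<Rightarrow> 'a"
    using that by induction (simp_all add: scaleC_add_right)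
  from this[OF finite] show ?thesis by (simp add: pencil_def scaleC_scaleC)
qed

lemma proj_resolvent_set_iff: "z \<in> proj_resolvent_set A \<longleftrightarrow> invertible_element (pencil A z)"
  by (simp add: proj_resolvent_set_def proj_spectrum_def)

lemma open_proj_resolvent_set: "open (proj_resolvent_set A)"
proof -
  have "proj_resolvent_set A = pencil A -` {x. invertible_element x}"
    by (auto simp: proj_resolvent_set_iff)
  then show ?thesis
    using open_vimage[OF open_invertible_elements linear_continuous_on[OF bounded_linear_pencil]]
    by simp
qed

text \<open>By the chain rule the derivative is
  \<open>v \<mapsto> \<phi> (- (g * pencil A v * g))\<close>. It is complex homogeneous because the
  pencil, the multiplication and \<open>\<phi>\<close> all are.\<close>

lemma resolvent_weakly_holomorphic:
  assumes "\<phi> \<in> cdual" and "S \<subseteq> proj_resolvent_set A"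
  shows "holomorphic_Cn_on (\<lambda>z. \<phi> (element_inverse (pencil A z))) S"
  unfolding holomorphic_Cn_on_def
proof
  fix z assume "z \<in> S"
  have \<phi>: "bounded_linear \<phi>" "\<And>c x. \<phi> (c *\<^sub>C x) = c * \<phi> x"
    using assms(1) by (auto simp: cdual_def)
  define g where "g = element_inverse (pencil A z)"
  have "(pencil A has_derivative pencil A) (at z within S)"
    by (rule bounded_linear_imp_has_derivative[OF bounded_linear_pencil])
  moreover have "(element_inverse has_derivative (\<lambda>h. - (g * h * g))) (at (pencil A z))"
    unfolding g_def using assms(2) \<open>z \<in> S\<close>
    by (intro has_derivative_element_inverse) (auto simp: proj_resolvent_set_iff[symmetric])
  ultimately have
    "((\<lambda>z. element_inverse (pencil A z)) has_derivative (\<lambda>v. - (g * pencil A v * g))) (at z within S)"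
    by (rule has_derivative_compose)
  then have "((\<lambda>z. \<phi> (element_inverse (pencil A z))) has_derivative
      (\<lambda>v. \<phi> (- (g * pencil A v * g)))) (at z within S)"
    by (rule bounded_linear.has_derivative[OF \<phi>(1)])
  moreover have "\<phi> (- (g * pencil A (c *s v) * g)) = c * \<phi> (- (g * pencil A v * g))" for c v
    by (simp add: pencil_scale mult_scaleC_left mult_scaleC_right \<phi>
        linear_neg[OF bounded_linear.linear[OF \<phi>(1)]])
  ultimately show "\<exists>D. ((\<lambda>z. \<phi> (element_inverse (pencil A z))) has_derivative D) (at z within S) \<and>
      (\<forall>c v. D (c *s v) = c * D v)"
    by blast
qed

text \<open>Norming functionals and uniform boundedness are proved for real functionals, while the
  test functions need elements of \<open>cdual\<close>. Since \<open>f\<close> is the real part of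
  this complex functional, bounds on the latter pass to \<open>f\<close>.\<close>

lemma complexified_functional:
  fixes f :: "'a::complex_normed_vector \<Rightarrow> real"
  assumes "bounded_linear f"
  shows "(\<lambda>x. Complex (f x) (- f (\<i> *\<^sub>C x))) \<in> cdual"
proof -
  interpret f: bounded_linear f by fact
  have i: "bounded_linear (\<lambda>x::'a. \<i> *\<^sub>C x)"
    by (rule bounded_linear_intro[where K = 1])
      (simp_all add: scaleC_add_right scaleR_scaleC scaleC_scaleC norm_scaleC mult.commute)
  have "bounded_linear (\<lambda>x. of_real (f x) - \<i> * of_real (f (\<i> *\<^sub>C x)) :: complex)"
    by (intro bounded_linear_intros bounded_linear_compose[OF assms i] assms bounded_linear_sub
        bounded_linear_compose[OF bounded_linear_of_real]
        bounded_linear_compose[OF bounded_linear_mult_right])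
  moreover have "(\<lambda>x. of_real (f x) - \<i> * of_real (f (\<i> *\<^sub>C x))) = (\<lambda>x. Complex (f x) (- f (\<i> *\<^sub>C x)))"
    by (auto simp: complex_eq_iff)
  ultimately have bl: "bounded_linear (\<lambda>x. Complex (f x) (- f (\<i> *\<^sub>C x)))"
    by simp
  have scale: "f (c *\<^sub>C x) = Re c * f x + Im c * f (\<i> *\<^sub>C x)" for c x
  proof -
    have "c *\<^sub>C x = Re c *\<^sub>R x + Im c *\<^sub>R (\<i> *\<^sub>C x)"
      by (simp add: scaleR_scaleC scaleC_scaleC flip: scaleC_add_left)
        (simp add: mult.commute flip: complex_eq)
    then show ?thesis by (simp add: f.add f.scaleR)
  qed
  have "f (\<i> *\<^sub>C c *\<^sub>C x) = Re c * f (\<i> *\<^sub>C x) - Im c * f x" for c x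
    unfolding scaleC_scaleC using scale[of "\<i> * c" x] by simp
  then have "Complex (f (c *\<^sub>C x)) (- f (\<i> *\<^sub>C c *\<^sub>C x)) = c * Complex (f x) (- f (\<i> *\<^sub>C x))" for c x
    by (simp add: complex_eq_iff scale[of c])
  then show ?thesis using bl by (simp add: cdual_def)
qed

section \<open>Identity theorem\<close>

lemma holomorphic_Cn_on_subset:
  "holomorphic_Cn_on f T \<Longrightarrow> S \<subseteq> T \<Longrightarrow> holomorphic_Cn_on f S"
  unfolding holomorphic_Cn_on_def by (meson has_derivative_subset subsetD)

lemma holomorphic_Cn_on_diff:
  assumes "holomorphic_Cn_on f S" "holomorphic_Cn_on g S"
  shows "holomorphic_Cn_on (\<lambda>z. f z - g z) S"
  unfolding holomorphic_Cn_on_def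
proof
  fix z assume "z \<in> S"
  then obtain D E where "(f has_derivative D) (at z within S)" "\<forall>c v. D (c *s v) = c * D v"
    "(g has_derivative E) (at z within S)" "\<forall>c v. E (c *s v) = c * E v"
    using assms unfolding holomorphic_Cn_on_def by blast
  then show "\<exists>D. ((\<lambda>z. f z - g z) has_derivative D) (at z within S) \<and> (\<forall>c v. D (c *s v) = c * D v)"
    by (intro exI[of _ "\<lambda>v. D v - E v"]) (auto intro: has_derivative_diff simp: algebra_simps)
qed

lemma bounded_linear_vector_scale_left: "bounded_linear (\<lambda>t::complex. t *s v)"
  unfolding linear_conv_bounded_linear[symmetric]
  by (rule linearI) (simp_all add: vec_eq_iff distrib_right)

text \<open>Restriction to complex lines reduces the identity theorem to one variable. Complex
  homogeneity \<open>D (t *s v) = t * D v\<close> is what turns the real derivative into a complex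
  one.\<close>

lemma holomorphic_on_complex_line:
  assumes "holomorphic_Cn_on f S"
  shows "(\<lambda>t. f (q + t *s v)) holomorphic_on {t. q + t *s v \<in> S}"
  unfolding holomorphic_on_def
proof
  fix t assume t: "t \<in> {t. q + t *s v \<in> S}"
  let ?T = "{t. q + t *s v \<in> S}"
  obtain D where D: "(f has_derivative D) (at (q + t *s v) within S)" "\<forall>c v. D (c *s v) = c * D v"
    using assms t unfolding holomorphic_Cn_on_def by blast
  have "((\<lambda>t. q + t *s v) has_derivative (\<lambda>t. t *s v)) (at t within ?T)"
    using bounded_linear_imp_has_derivative[OF bounded_linear_vector_scale_left]
    by (auto intro!: derivative_eq_intros)
  moreover have "(f has_derivative D) (at (q + t *s v) within (\<lambda>t. q + t *s v) ` ?T)"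
    using D(1) by (rule has_derivative_subset) auto
  ultimately have "((\<lambda>t. f (q + t *s v)) has_derivative (\<lambda>t. D (t *s v))) (at t within ?T)"
    using has_derivative_in_compose by blast
  then have "((\<lambda>t. f (q + t *s v)) has_field_derivative D v) (at t within ?T)"
    by (rule has_derivative_imp_has_field_derivative) (simp add: D(2))
  then show "(\<lambda>t. f (q + t *s v)) field_differentiable at t within ?T"
    by (auto simp: field_differentiable_def)
qed

text \<open>The complex line through \<open>q\<close> and \<open>w\<close> meets the ball in a
  convex set of parameters, so the one-variable identity theorem applies. For a general connected
  set such a slice may be disconnected, hence the local version first.\<close>

lemma holomorphic_Cn_zero_on_ball:
  assumes f: "holomorphic_Cn_on f (ball p r)" and "q \<in> ball p r" and "w \<in> ball p r"
    and Z: "open Z" "q \<in> Z" "\<And>z. z \<in> Z \<Longrightarrow> f z = 0"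
  shows "f w = 0"
proof -
  let ?l = "\<lambda>t. q + t *s (w - q)"
  let ?T = "{t. ?l t \<in> ball p r}"
  have cont: "continuous_on UNIV ?l"
    by (intro continuous_intros linear_continuous_on bounded_linear_vector_scale_left)
  have "open ?T" "open {t. ?l t \<in> Z}"
    using open_vimage[OF open_ball cont] open_vimage[OF Z(1) cont] by (simp_all add: vimage_def)
  have "convex ?T"
  proof -
    have "?T = (\<lambda>t. t *s (w - q)) -` ((\<lambda>x. x - q) ` ball p r)"
      by (force simp: algebra_simps)
    moreover have "convex \<dots>"
      by (rule convex_linear_vimage)
        (simp_all only: bounded_linear.linear[OF bounded_linear_vector_scale_left]
          convex_translation_subtract_eq convex_ball)
    ultimately show ?thesis by simp
  qed
  \<comment> \<open>The line passes through \<open>q\<close> at parameter 0, near which it stays in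
    \<open>Z\<close>, and through \<open>w\<close> at parameter 1.\<close>
  have "f (?l 1) = 0"
  proof (rule analytic_continuation_open[where f = "\<lambda>t. f (?l t)" and g = "\<lambda>_. 0" and s = "{t. ?l t \<in> Z} \<inter> ?T" and s' = ?T])
    show "open ({t. ?l t \<in> Z} \<inter> ?T)" "open ?T"
      using \<open>open ?T\<close> \<open>open {t. ?l t \<in> Z}\<close> by auto
    show "{t. ?l t \<in> Z} \<inter> ?T \<noteq> {}"
    proof -
      have "0 \<in> {t. ?l t \<in> Z} \<inter> ?T" using assms(2) Z(2) by simp
      then show ?thesis by blast
    qed
    show "connected ?T" using \<open>convex ?T\<close> by (rule convex_connected)
    show "(\<lambda>t. f (?l t)) holomorphic_on ?T"
      using f by (rule holomorphic_on_complex_line)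
  qed (use assms(3) Z(3) in auto)
  then show ?thesis by simp
qed

text \<open>The interior of the zero set has no frontier point in \<open>W\<close>: a ball around
  such a point would meet it, and by the local version \<open>f\<close> would vanish on the whole
  ball.\<close>

lemma holomorphic_Cn_zero:
  assumes f: "holomorphic_Cn_on f W" and W: "open W" "connected W"
    and U: "open U" "U \<noteq> {}" "U \<subseteq> W" "\<And>z. z \<in> U \<Longrightarrow> f z = 0" and "w \<in> W"
  shows "f w = 0"
proof -
  define Z where "Z = interior {z \<in> W. f z = 0}"
  have Z: "open Z" "Z \<subseteq> W" "\<And>z. z \<in> Z \<Longrightarrow> f z = 0"
    using interior_subset[of "{z \<in> W. f z = 0}"] by (auto simp: Z_def)
  have "U \<subseteq> Z"
    unfolding Z_def using U by (intro interior_maximal) auto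
  have "W \<inter> frontier Z = {}"
  proof (intro equals0I)
    fix p assume p: "p \<in> W \<inter> frontier Z"
    then obtain r where "r > 0" and r: "ball p r \<subseteq> W"
      using W(1) open_contains_ball by blast
    obtain q where q: "q \<in> Z" "q \<in> ball p r"
      using p \<open>r > 0\<close> by (auto simp: frontier_def closure_approachable dist_commute)
    have "f z = 0" if "z \<in> ball p r" for z
      using holomorphic_Cn_zero_on_ball[OF holomorphic_Cn_on_subset[OF f r] q(2) that Z(1) q(1)] Z(3)
      by blast
    then have "ball p r \<subseteq> Z"
      unfolding Z_def using r by (intro interior_maximal) auto
    then have "p \<in> Z" using \<open>r > 0\<close> by auto
    then show False using p Z(1) by (simp add: frontier_def interior_open)
  qed
  then have "W \<subseteq> Z"
    using connected_Int_frontier[OF W(2), of Z] U \<open>U \<subseteq> Z\<close> by blast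
  then show ?thesis using Z \<open>w \<in> W\<close> by blast
qed

lemma holomorphic_Cn_identity:
  assumes "holomorphic_Cn_on f W" "holomorphic_Cn_on g W" "open W" "connected W"
    and "open U" "U \<noteq> {}" "U \<subseteq> W" "\<And>z. z \<in> U \<Longrightarrow> f z = g z" and "w \<in> W"
  shows "f w = g w"
  using holomorphic_Cn_zero[OF holomorphic_Cn_on_diff[OF assms(1,2)] assms(3-7) _ assms(9)] assms(8)
  by simp

section \<open>Components of the resolvent set\<close>

text \<open>Components are relatively closed. This is used to pull a limit point back into its
  component as soon as it lies in the ambient set.\<close>

lemma closure_component_Int:
  assumes "C \<in> components S"
  shows "closure C \<inter> S = C"
proof -
  obtain T where "closed T" "C = S \<inter> T"
    using closedin_component[OF assms] by (auto simp: closedin_closed)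
  then show ?thesis
    using closure_minimal[of C T] closure_subset[of C] by blast
qed

text \<open>Holomorphy of the extensions enters only through continuity at \<open>p\<close>.
  Agreement is demanded on all of \<open>W\<close> because the sequence approaching \<open>p\<close>
  runs through \<open>W\<close>.\<close>

lemma no_extension_at_singular_point:
  fixes A :: "'b::complex_banach_algebra_1 ^ 'n::finite"
  assumes W: "W \<subseteq> proj_resolvent_set A" and p: "p \<in> closure W" "p \<in> V"
    and ext: "\<And>\<phi>. \<phi> \<in> cdual \<Longrightarrow> \<exists>F. holomorphic_Cn_on F V \<and>
      (\<forall>z\<in>W. F z = \<phi> (element_inverse (pencil A z)))" and "open V"
  shows "p \<in> proj_resolvent_set A"
proof -
  obtain z where z: "\<And>k. z k \<in> W" "z \<longlonglongrightarrow> p"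
    using p(1) by (auto simp: closure_sequential)
  define g where "g k = element_inverse (pencil A (z k))" for k
  have "bounded (range g)"
  proof (rule weakly_bounded_imp_bounded)
    fix f :: "'b \<Rightarrow>\<^sub>L real"
    let ?\<phi> = "\<lambda>x. Complex (blinfun_apply f x) (- blinfun_apply f (\<i> *\<^sub>C x))"
    have "?\<phi> \<in> cdual"
      by (rule complexified_functional) (rule blinfun.bounded_linear_right)
    from ext[OF this] obtain F where F: "holomorphic_Cn_on F V"
      and Fz: "\<And>w. w \<in> W \<Longrightarrow> F w = ?\<phi> (element_inverse (pencil A w))"
      by blast
    obtain D where "(F has_derivative D) (at p within V)"
      using F p(2) unfolding holomorphic_Cn_on_def by blast
    then have "isCont F p"
      using has_derivative_continuous at_within_open[OF p(2) \<open>open V\<close>] by metis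
    then have "(\<lambda>k. F (z k)) \<longlonglongrightarrow> F p"
      using z(2) by (rule isCont_tendsto_compose)
    then have "bounded (range (\<lambda>k. F (z k)))"
      by (rule convergent_imp_bounded)
    then obtain B where B: "\<And>k. cmod (F (z k)) \<le> B"
      by (auto simp: bounded_iff)
    have "\<bar>blinfun_apply f (g k)\<bar> \<le> B" for k
      using abs_Re_le_cmod[of "F (z k)"] B[of k] Fz[OF z(1), of k] by (simp add: g_def)
    then show "bounded (blinfun_apply f ` range g)"
      by (auto simp: bounded_iff)
  qed
  then obtain M where M: "\<And>k. norm (g k) \<le> M"
    by (auto simp: bounded_iff)
  \<comment> \<open>The bound \<open>M\<close> does not depend on \<open>k\<close>, so for some
    \<open>k\<close> the point \<open>pencil A p\<close> falls within the radius of invertibility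
    around \<open>pencil A (z k)\<close>.\<close>
  have "(\<lambda>k. pencil A (z k)) \<longlonglongrightarrow> pencil A p"
    using bounded_linear_pencil z(2) by (rule bounded_linear.tendsto)
  then have "(\<lambda>k. M * norm (pencil A p - pencil A (z k))) \<longlonglongrightarrow> M * norm (pencil A p - pencil A p)"
    by (intro tendsto_intros)
  then have "\<forall>\<^sub>F k in sequentially. M * norm (pencil A p - pencil A (z k)) < 1"
    by (rule order_tendstoD) simp
  then obtain k where k: "M * norm (pencil A p - pencil A (z k)) < 1"
    by (auto simp: eventually_sequentially)
  have "norm (g k) * norm (pencil A p - pencil A (z k)) < 1"
    using k M by (meson mult_right_mono norm_ge_zero order_le_less_trans)
  moreover have "invertible_element (pencil A (z k))"
    using z(1)[of k] W by (auto simp flip: proj_resolvent_set_iff)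
  ultimately have "invertible_element (pencil A (z k) + (pencil A p - pencil A (z k)))"
    unfolding g_def using element_inverse by (intro invertible_element_perturb)
  then show ?thesis by (simp add: proj_resolvent_set_iff)
qed

theorem theorem2p3:
  fixes A :: "'b::complex_banach_algebra_1 ^ 'n::finite" and n :: nat
    and \<Omega> :: "(complex ^ 'n) set"
  assumes "n \<ge> 1" and "CARD('n) = n + 1"
    and "reflexive_space TYPE('b)"
    and "\<Omega> \<in> components (proj_resolvent_set A)"
  shows "domain_of_holomorphy \<Omega>"
proof -
  let ?R = "proj_resolvent_set A"
  have \<Omega>: "open \<Omega>" "connected \<Omega>" "\<Omega> \<noteq> {}"
    using assms(4) open_components[OF open_proj_resolvent_set]
      in_components_connected in_components_nonempty by blast+
  have False if U: "open U" "U \<noteq> {}" "U \<subseteq> V \<inter> \<Omega>"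
    and V: "open V" "connected V" "\<not> V \<subseteq> \<Omega>"
    and ext: "\<And>f. holomorphic_Cn_on f \<Omega> \<Longrightarrow> \<exists>F. holomorphic_Cn_on F V \<and> (\<forall>z\<in>U. F z = f z)" for U V
  proof -
    obtain u where "u \<in> U" using U(2) by blast
    \<comment> \<open>\<open>V \<inter> \<Omega>\<close> may be disconnected, and agreement on
      \<open>U\<close> propagates only through the components that \<open>U\<close> meets.
      \<open>W\<close> is one of these.\<close>
    define W where "W = connected_component_set (V \<inter> \<Omega>) u"
    have W: "W \<in> components (V \<inter> \<Omega>)"
      using \<open>u \<in> U\<close> U(3) by (auto simp: W_def components_def)
    have "open (V \<inter> \<Omega>)" using V \<Omega> by blast
    then have "open W" using W open_components by blast
    have "connected W" "W \<subseteq> V \<inter> \<Omega>"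
      using W in_components_connected in_components_subset by blast+
    have "u \<in> W"
      using \<open>u \<in> U\<close> U(3) by (auto simp: W_def)
    \<comment> \<open>The connected set \<open>V\<close> meets \<open>W\<close> but is not contained
      in it, since it is not contained in \<open>\<Omega>\<close>; hence it contains a frontier
      point of \<open>W\<close>.\<close>
    then obtain p where p: "p \<in> V" "p \<in> frontier W"
      using connected_Int_frontier[OF V(2), of W] \<open>W \<subseteq> V \<inter> \<Omega>\<close> V(3) by blast
    then have pW: "p \<in> closure W" "p \<notin> W"
      using \<open>open W\<close> by (auto simp: frontier_def interior_open)
    have "p \<in> ?R"
    proof (rule no_extension_at_singular_point[OF _ pW(1) p(1) _ V(1)])
      show "W \<subseteq> ?R"
        using \<open>W \<subseteq> V \<inter> \<Omega>\<close> in_components_subset[OF assms(4)] by blast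
      fix \<phi> :: "'b \<Rightarrow> complex" assume "\<phi> \<in> cdual"
      let ?f = "\<lambda>z. \<phi> (element_inverse (pencil A z))"
      have f: "holomorphic_Cn_on ?f \<Omega>"
        using \<open>\<phi> \<in> cdual\<close> in_components_subset[OF assms(4)] by (rule resolvent_weakly_holomorphic)
      then obtain F where F: "holomorphic_Cn_on F V" "\<And>z. z \<in> U \<Longrightarrow> F z = ?f z"
        using ext by blast
      have "F z = ?f z" if "z \<in> W" for z
      \<comment> \<open>The identity theorem starts from \<open>U \<inter> W\<close>, an open set
        that contains \<open>u\<close>.\<close>
      proof (rule holomorphic_Cn_identity[where U = "U \<inter> W", OF _ _ \<open>open W\<close> \<open>connected W\<close>])
        show "holomorphic_Cn_on F W" "holomorphic_Cn_on ?f W"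
          using F(1) f \<open>W \<subseteq> V \<inter> \<Omega>\<close> by (auto intro: holomorphic_Cn_on_subset)
      qed (use U(1) \<open>open W\<close> \<open>u \<in> U\<close> \<open>u \<in> W\<close> F(2) that in auto)
      then show "\<exists>F. holomorphic_Cn_on F V \<and> (\<forall>z\<in>W. F z = ?f z)"
        using F(1) by blast
    qed
    moreover have "p \<in> closure \<Omega>"
      using pW(1) closure_mono[of W \<Omega>] \<open>W \<subseteq> V \<inter> \<Omega>\<close> by blast
    \<comment> \<open>Relative closedness is used twice: \<open>\<Omega>\<close> in the resolvent
      set puts \<open>p\<close> into \<open>\<Omega>\<close>, then \<open>W\<close> in
      \<open>V \<inter> \<Omega>\<close> puts \<open>p\<close> into \<open>W\<close>, although the
      open set \<open>W\<close> contains none of its frontier points.\<close>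
    ultimately have "p \<in> \<Omega>"
      using closure_component_Int[OF assms(4)] by blast
    then have "p \<in> W"
      using closure_component_Int[OF W] pW(1) p(1) by blast
    then show False using pW(2) by contradiction
  qed
  then show ?thesis
    unfolding domain_of_holomorphy_def using \<Omega> by blast
qed

end
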